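(* Let $Q$ be a nonzero commutative unital ring, let $n$ be a positive integer, let $\mathbf w=(w_1,\ldots,w_n)\in\mathbb Z_{\ge1}^n$ and let $k$ be a positive integer. Let $R_{\mathbf w}$ be the Rees ring of $\mathbf w$ over $Q$. Then $R_{\mathbf w}^{(kd_{\mathbf w})}$ is generated in degree $1$ if and only if there is no $\mathbf w$-bubble $\mathbf u$ such that the triple $(\mathbf w,\mathbf u,k)$ satisfies the following condition: there exist vectors $\mathbf v_1,\ldots,\mathbf v_r\in V_{\mathbf w}(d_{\mathbf w})$, where $m:=\max\left(1,\left\lceil\left\lfloor\frac{\mathbf w\cdot\mathbf u}{d_{\mathbf w}}\right\rfloor/k\right\rceil\right)$ and $r:=mk-\left\lfloor\frac{\mathbf w\cdot\mathbf u}{d_{\mathbf w}}\right\rfloor$, such that $$\mathbf u+\mathbf v_1+\ldots+\mathbf v_r\notin mV_{\mathbf w}^+(kd_{\mathbf w}).$$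
   Context: Notation: $d_{\mathbf w}=\operatorname{lcm}(w_1,\ldots,w_n)$; $\mathbf a\cdot\mathbf b=\sum_ia_ib_i$; $\mathbf a\preceq\mathbf b$ means $a_i\le b_i$ for all $i$. For a positive integer $m$: $V_{\mathbf w}(m)=\{\mathbf v\in\mathbb Z_{\ge0}^n\mid\mathbf w\cdot\mathbf v=m\}$ and $V^+_{\mathbf w}(m)=\{\mathbf v\in\mathbb Z_{\ge0}^n\mid\mathbf w\cdot\mathbf v\ge m\}$. For $S\subseteq\mathbb Z_{\ge0}^n$ and a positive integer $m$, $mS$ is the Minkowski sum $S+\ldots+S$ with $m$ summands. A $\mathbf w$-bubble is an element $\mathbf u\in\mathbb Z_{\ge0}^n$ such that $\mathbf w\cdot\mathbf u\ge2d_{\mathbf w}$ and there is no $\mathbf v\in\mathbb Z_{\ge0}^n$ with $\mathbf w\cdot\mathbf v=d_{\mathbf w}$ and $\mathbf v\preceq\mathbf u$. The Rees ring is the subring $R_{\mathbf w}:=Q[\{t^dx_i\mid i\in\{1,\ldots,n\},\ d\in\{0,\ldots,w_i\}\}]$ of $Q[t,x_1,\ldots,x_n]$, graded by the degree in $t$ (so $x_1,\dots,x_n$ have degree $0$); equivalently the nonnegative-degree part of $Q[t^{-1},t^{w_1}x_1,\ldots,t^{w_n}x_n]$. For a $\mathbb Z_{\ge0}$-graded ring $S$ and an integer $r\ge1$, the $r$th Veronese subring is $S^{(r)}:=\bigoplus_{m\ge0}S_{rm}$, where $S_{rm}$ is the $m$th graded component of $S^{(r)}$. A graded ring $S$ is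 generated in degree $1$ if $S=S_0\oplus\bigoplus_{m\ge1}S_1^m$, where $S_1^m$ is the additive subgroup generated by $m$-fold products of elements of $S_1$. *)

theory Defs
  imports
    "HOL-Analysis.Finite_Cartesian_Product"
    "HOL-Library.Poly_Mapping"
    "HOL-Library.Product_Plus"
    "HOL-Computational_Algebra.Group_Closure"
begin

section \<open>Vectors of nonnegative integers\<close>

text \<open>
  Weights and vectors in $\mathbb{Z}_{\ge 0}^n$ have type \<open>nat ^ 'n\<close>, so \<open>n\<close> is the (automatically
  positive) cardinality of the finite type \<open>'n\<close>. The dot product is the library's
  \<^const>\<open>scalar_product\<close>, and \<open>\<le>\<close> on vectors is the componentwise order.
\<close>

definition lcm_weight :: "nat ^ 'n \<Rightarrow> nat"
  where "lcm_weight w = (LCM i. w $ i)"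

definition V :: "nat ^ 'n \<Rightarrow> nat \<Rightarrow> (nat ^ 'n) set"
  where "V w m = {v. scalar_product w v = m}"

definition V_plus :: "nat ^ 'n \<Rightarrow> nat \<Rightarrow> (nat ^ 'n) set"
  where "V_plus w m = {v. scalar_product w v \<ge> m}"

definition minkowski_multiple :: "nat \<Rightarrow> 'a::comm_monoid_add set \<Rightarrow> 'a set"
  where "minkowski_multiple m S = {(\<Sum>i<m. s i) | s. \<forall>i<m. s i \<in> S}"

definition bubble :: "nat ^ 'n \<Rightarrow> nat ^ 'n \<Rightarrow> bool"
  where "bubble w u \<longleftrightarrow>
    scalar_product w u \<ge> 2 * lcm_weight w \<and>
    \<not> (\<exists>v. scalar_product w v = lcm_weight w \<and> v \<le> u)"


section \<open>Graded rings\<close>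

inductive_set ring_closure :: "'a::comm_ring_1 set \<Rightarrow> 'a set" for S
  where
    one: "1 \<in> ring_closure S"
  | base: "s \<in> S \<Longrightarrow> s \<in> ring_closure S"
  | diff: "s \<in> ring_closure S \<Longrightarrow> t \<in> ring_closure S \<Longrightarrow> s - t \<in> ring_closure S"
  | mult: "s \<in> ring_closure S \<Longrightarrow> t \<in> ring_closure S \<Longrightarrow> s * t \<in> ring_closure S"

definition sum_subgroups :: "(nat \<Rightarrow> 'a::ab_group_add set) \<Rightarrow> 'a set"
  where "sum_subgroups A = group_closure (\<Union>m. A m)"

text \<open>\<open>is_direct_sum R A\<close> says that $R = \bigoplus_{m \ge 0} A_m$ as an internal direct sum of
  additive subgroups.\<close>

definition is_direct_sum :: "'a::ab_group_add set \<Rightarrow> (nat \<Rightarrow> 'a set) \<Rightarrow> bool"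
  where "is_direct_sum R A \<longleftrightarrow>
    (\<forall>m. group_closure (A m) = A m) \<and>
    R = sum_subgroups A \<and>
    (\<forall>a N. (\<forall>m. a m \<in> A m) \<and> (\<Sum>m\<le>N. a m) = 0 \<longrightarrow> (\<forall>m\<le>N. a m = 0))"

definition graded_ring :: "'a::comm_ring_1 set \<Rightarrow> (nat \<Rightarrow> 'a set) \<Rightarrow> bool"
  where "graded_ring S A \<longleftrightarrow>
    ring_closure S = S \<and> is_direct_sum S A \<and>
    (\<forall>i j. \<forall>a\<in>A i. \<forall>b\<in>A j. a * b \<in> A (i + j))"

text \<open>\<open>power_subgroup X m\<close> is $X^m$, the additive subgroup generated by the \<open>m\<close>-fold products of
  elements of \<open>X\<close>.\<close>

definition power_subgroup :: "'a::comm_ring_1 set \<Rightarrow> nat \<Rightarrow> 'a set"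
  where "power_subgroup X m = group_closure {(\<Prod>i<m. f i) | f. \<forall>i<m. f i \<in> X}"

definition generated_in_degree_1 :: "'a::comm_ring_1 set \<Rightarrow> (nat \<Rightarrow> 'a set) \<Rightarrow> bool"
  where "generated_in_degree_1 S A \<longleftrightarrow>
    is_direct_sum S (\<lambda>m. if m = 0 then A 0 else power_subgroup (A 1) m)"

text \<open>The \<open>r\<close>th Veronese subring of a graded ring with components \<open>A\<close>, and its own grading.\<close>

definition veronese_component :: "nat \<Rightarrow> (nat \<Rightarrow> 'a set) \<Rightarrow> nat \<Rightarrow> 'a set"
  where "veronese_component r A m = A (r * m)"

definition veronese :: "nat \<Rightarrow> (nat \<Rightarrow> 'a::comm_ring_1 set) \<Rightarrow> 'a set"
  where "veronese r A = sum_subgroups (veronese_component r A)"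


section \<open>The Rees ring\<close>

text \<open>
  The polynomial ring $Q[t, x_1, \ldots, x_n]$ is represented as the monoid algebra of
  $\mathbb{Z}_{\ge 0} \times \mathbb{Z}_{\ge 0}^n$ over \<open>Q\<close>: the exponent \<open>(d, v)\<close> stands for the
  monomial $t^d x^v$. Poly_Mapping's multiplication is convolution, and \<open>comm_ring_1\<close> includes
  \<open>0 \<noteq> 1\<close>, so \<open>Q\<close> is nonzero.
\<close>

type_synonym ('q, 'n) tx_poly = "(nat \<times> (nat ^ 'n)) \<Rightarrow>\<^sub>0 'q"

definition monomial_tx :: "nat \<Rightarrow> nat ^ 'n \<Rightarrow> ('q::comm_ring_1, 'n) tx_poly"
  where "monomial_tx d v = Poly_Mapping.single (d, v) 1"

definition const_tx :: "'q::comm_ring_1 \<Rightarrow> ('q, 'n::finite) tx_poly"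
  where "const_tx c = Poly_Mapping.single 0 c"

text \<open>\<open>axis i 1\<close> is the \<open>i\<close>th standard basis vector, so \<open>monomial_tx d (axis i 1)\<close> is $t^d x_i$.\<close>

definition rees_ring :: "nat ^ 'n \<Rightarrow> ('q::comm_ring_1, 'n) tx_poly set"
  where "rees_ring w =
    ring_closure (range const_tx \<union> {monomial_tx d (axis i 1) | d i. d \<le> w $ i})"

definition rees_component :: "nat ^ 'n \<Rightarrow> nat \<Rightarrow> ('q::comm_ring_1, 'n) tx_poly set"
  where "rees_component w d = {p \<in> rees_ring w. \<forall>e \<in> Poly_Mapping.keys p. fst e = d}"


section \<open>The condition on bubbles\<close>

text \<open>
  The subtraction in \<open>bubble_r\<close> is never truncated for \<open>k > 0\<close>, see \<open>bubble_r_no_truncation\<close>.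
\<close>

definition bubble_level :: "nat ^ 'n \<Rightarrow> nat ^ 'n \<Rightarrow> nat"
  where "bubble_level w u = nat \<lfloor>real (scalar_product w u) / real (lcm_weight w)\<rfloor>"

definition bubble_m :: "nat ^ 'n \<Rightarrow> nat ^ 'n \<Rightarrow> nat \<Rightarrow> nat"
  where "bubble_m w u k = max 1 (nat \<lceil>real (bubble_level w u) / real k\<rceil>)"

definition bubble_r :: "nat ^ 'n \<Rightarrow> nat ^ 'n \<Rightarrow> nat \<Rightarrow> nat"
  where "bubble_r w u k = bubble_m w u k * k - bubble_level w u"

definition bubble_condition :: "nat ^ 'n \<Rightarrow> nat ^ 'n \<Rightarrow> nat \<Rightarrow> bool"
  where "bubble_condition w u k \<longleftrightarrow>
    (\<exists>v :: nat \<Rightarrow> nat ^ 'n.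
      (\<forall>i < bubble_r w u k. v i \<in> V w (lcm_weight w)) \<and>
      u + (\<Sum>i < bubble_r w u k. v i)
        \<notin> minkowski_multiple (bubble_m w u k) (V_plus w (k * lcm_weight w)))"

lemma bubble_r_no_truncation:
  assumes "k > 0"
  shows "bubble_level w u \<le> bubble_m w u k * k"
proof -
  have "real (bubble_level w u) / real k \<le> real (bubble_m w u k)"
    unfolding bubble_m_def by linarith
  then have "real (bubble_level w u) \<le> real (bubble_m w u k * k)"
    using assms by (simp add: field_simps)
  then show ?thesis by linarith
qed


section \<open>The Rees ring and its Veronese subrings are graded rings\<close>

lemma group_closure_eqI:
  assumes "0 \<in> A" "\<And>a b. a \<in> A \<Longrightarrow> b \<in> A \<Longrightarrow> a - b \<in> A"
  shows "group_closure A = A"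
proof
  show "group_closure A \<subseteq> A"
  proof
    fix x assume "x \<in> group_closure A"
    then show "x \<in> A" by (induction rule: group_closure.induct) (use assms in auto)
  qed
qed (auto intro: group_closure.base)

lemma ring_closure_zero: "0 \<in> ring_closure S"
  using ring_closure.diff[OF ring_closure.one ring_closure.one] by simp

lemma group_closure_mult:
  fixes A :: "nat \<Rightarrow> 'a::comm_ring_1 set"
  assumes m: "\<And>i j a b. a \<in> A i \<Longrightarrow> b \<in> A j \<Longrightarrow> a * b \<in> A (i + j)"
    and x: "x \<in> sum_subgroups A" and y: "y \<in> sum_subgroups A"
  shows "x * y \<in> sum_subgroups A"
proof -
  have *: "a * y \<in> sum_subgroups A" if "a \<in> A i" for a i
    using y unfolding sum_subgroups_def
  proof (induction rule: group_closure.induct)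
    case (base s)
    then consider "s = 0" | j where "s \<in> A j" by auto
    then show ?case
      by cases (auto intro!: group_closure.base m that)
  next
    case (diff s t)
    then show ?case by (simp add: right_diff_distrib group_closure.diff)
  qed
  show ?thesis
    using x unfolding sum_subgroups_def
  proof (induction rule: group_closure.induct)
    case (base s)
    then show ?case using * by (auto simp: sum_subgroups_def)
  next
    case (diff s t)
    then show ?case by (simp add: left_diff_distrib group_closure.diff)
  qed
qed

lemma graded_ringI:
  fixes A :: "nat \<Rightarrow> 'a::comm_ring_1 set"
  assumes "1 \<in> A 0" "is_direct_sum (sum_subgroups A) A"
    and m: "\<And>i j a b. a \<in> A i \<Longrightarrow> b \<in> A j \<Longrightarrow> a * b \<in> A (i + j)"
  shows "graded_ring (sum_subgroups A) A"
proof -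
  have "x \<in> sum_subgroups A" if "x \<in> ring_closure (sum_subgroups A)" for x
    using that
  proof (induction rule: ring_closure.induct)
    case one
    show ?case using assms(1) unfolding sum_subgroups_def by (auto intro: group_closure.base)
  next
    case (diff s t)
    then show ?case unfolding sum_subgroups_def by (auto intro: group_closure.diff)
  next
    case (mult s t)
    show ?case using m mult.IH by (rule group_closure_mult)
  qed
  then have "ring_closure (sum_subgroups A) = sum_subgroups A"
    by (auto intro: ring_closure.base)
  with assms(2) m show ?thesis unfolding graded_ring_def by blast
qed

lemma rees_component_mult:
  assumes "a \<in> rees_component w i" "b \<in> rees_component w j"
  shows "a * b \<in> rees_component w (i + j)"
  using assms keys_mult[of a b] unfolding rees_component_def rees_ring_def
  by (fastforce intro: ring_closure.mult)

lemma rees_component_diff: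
  assumes "a \<in> rees_component w i" "b \<in> rees_component w i"
  shows "a - b \<in> rees_component w i"
  using assms keys_diff[of a b] unfolding rees_component_def rees_ring_def
  by (fastforce intro: ring_closure.diff)

lemma rees_component_const: "const_tx c \<in> rees_component w 0"
proof -
  have "const_tx c \<in> rees_ring w"
    unfolding rees_ring_def by (rule ring_closure.base) simp
  then show ?thesis
    by (auto simp: rees_component_def const_tx_def)
qed

lemma one_eq_const: "1 = (const_tx 1 :: ('q::comm_ring_1, 'n::finite) tx_poly)"
  by (simp add: const_tx_def)

lemma rees_component_independent:
  fixes a :: "nat \<Rightarrow> ('q::comm_ring_1, 'n::finite) tx_poly"
  assumes a: "\<And>m. a m \<in> rees_component w (f m)" and "inj f" and z: "(\<Sum>m\<le>N. a m) = 0" and "m \<le> N"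
  shows "a m = 0"
proof (rule poly_mapping_eqI)
  fix e
  show "Poly_Mapping.lookup (a m) e = Poly_Mapping.lookup 0 e"
  proof (cases "fst e = f m")
    case False
    then show ?thesis using a[of m] by (auto simp: rees_component_def in_keys_iff)
  next
    case True
    have "0 = (\<Sum>j\<le>N. Poly_Mapping.lookup (a j) e)"
      using z by (metis lookup_sum lookup_zero)
    also have "\<dots> = (\<Sum>j\<le>N. if j = m then Poly_Mapping.lookup (a m) e else 0)"
    proof (rule sum.cong)
      fix j
      show "Poly_Mapping.lookup (a j) e = (if j = m then Poly_Mapping.lookup (a m) e else 0)"
      proof (cases "j = m")
        case False
        then have "fst e \<noteq> f j" using True \<open>inj f\<close> by (auto dest: injD)
        then have "e \<notin> Poly_Mapping.keys (a j)" using a[of j] by (auto simp: rees_component_def)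
        with False show ?thesis by (simp add: in_keys_iff)
      qed simp
    qed simp
    also have "\<dots> = Poly_Mapping.lookup (a m) e" using \<open>m \<le> N\<close> by simp
    finally show ?thesis by simp
  qed
qed

lemma rees_component_closed: "group_closure (rees_component w m) = rees_component w m"
proof (rule group_closure_eqI)
  show "0 \<in> rees_component w m"
    by (simp add: rees_component_def rees_ring_def ring_closure_zero)
qed (rule rees_component_diff)

lemma graded_ring_veronese:
  fixes w :: "nat ^ 'n"
  assumes "r > 0"
  shows "graded_ring (veronese r (rees_component w :: nat \<Rightarrow> ('q::comm_ring_1, 'n) tx_poly set))
           (veronese_component r (rees_component w))"
  unfolding veronese_def
proof (rule graded_ringI)
  show "1 \<in> veronese_component r (rees_component w :: nat \<Rightarrow> ('q, 'n) tx_poly set) 0"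
    by (simp add: veronese_component_def one_eq_const rees_component_const)
  have "inj (\<lambda>m. r * m)" using assms by (auto simp: inj_def)
  then show "is_direct_sum (sum_subgroups (veronese_component r (rees_component w)))
      (veronese_component r (rees_component w :: nat \<Rightarrow> ('q, 'n) tx_poly set))"
    using rees_component_independent[where f = "\<lambda>m. r * m"]
    unfolding is_direct_sum_def veronese_component_def
    by (auto simp: rees_component_closed)
qed (auto simp: veronese_component_def algebra_simps dest: rees_component_mult)

lemma rees_ring_eq_sum: "rees_ring w = sum_subgroups (rees_component w)"
proof
  show "sum_subgroups (rees_component w) \<subseteq> rees_ring w"
  proof
    fix x assume "x \<in> sum_subgroups (rees_component w)"
    then show "x \<in> rees_ring w"
      unfolding sum_subgroups_def
      by (induction rule: group_closure.induct)
        (auto simp: rees_component_def rees_ring_def ring_closure_zero intro: ring_closure.diff)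
  qed
  have gen: "p \<in> sum_subgroups (rees_component w)" if "p \<in> rees_component w d" for p d
    using that unfolding sum_subgroups_def by (auto intro: group_closure.base)
  show "rees_ring w \<subseteq> sum_subgroups (rees_component w)"
  proof
    fix x assume "x \<in> rees_ring w"
    then show "x \<in> sum_subgroups (rees_component w)"
      unfolding rees_ring_def[of w]
    proof (induction rule: ring_closure.induct)
      case one
      show ?case by (rule gen[of _ 0]) (simp add: one_eq_const rees_component_const)
    next
      case (base s)
      then consider c where "s = const_tx c" | d i where "s = monomial_tx d (axis i 1)" "d \<le> w $ i"
        by auto
      then show ?case
      proof cases
        case 1
        then show ?thesis using gen[OF rees_component_const] by simp
      next
        case 2
        have "s \<in> rees_component w d"
          using 2 base unfolding rees_component_def rees_ring_def
          by (auto intro: ring_closure.base simp: monomial_tx_def)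
        then show ?thesis by (rule gen)
      qed
    next
      case (diff s t)
      then show ?case unfolding sum_subgroups_def by (auto intro: group_closure.diff)
    next
      case (mult s t)
      show ?case using rees_component_mult mult.IH by (rule group_closure_mult)
    qed
  qed
qed

lemma graded_ring_rees:
  "graded_ring (rees_ring w :: ('q::comm_ring_1, 'n::finite) tx_poly set) (rees_component w)"
  using graded_ring_veronese[of 1 w, where 'q = 'q]
  by (simp add: rees_ring_eq_sum veronese_def veronese_component_def[abs_def])

end

theory Submission
  imports Defs "HOL-Library.Multiset"
begin

text \<open>
  Write $D = d_{\mathbf w}$. Since $R_{\mathbf w}$ is spanned by the monomials $t^d x^{\mathbf v}$ with
  $d \le \mathbf w\cdot\mathbf v$, generation in degree 1 means
  $V^+_{\mathbf w}(mkD) \subseteq mV^+_{\mathbf w}(kD)$ for all $m \ge 1$; this inclusion contradicts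
  the condition on any bubble. Conversely, let $\mathbf w\cdot\mathbf v \ge mkD$. If even
  $\mathbf w\cdot\mathbf v \ge (mk+1)D$, then $\mathbf v \in mV^+_{\mathbf w}(kD)$ without any
  hypothesis, by a bin covering argument: every weight is $D/q$ for some integer $q$, and unit
  fractions of total at least $m + \frac12$ can be distributed over $m$ bins so that each bin
  receives at least 1. Otherwise, split off elements of $V_{\mathbf w}(D)$ from $\mathbf v$ until
  none is left below the remainder $\mathbf u$. Exactly
  $mk - \lfloor\mathbf w\cdot\mathbf u/D\rfloor$ elements have been split off, which is enough to
  apply the hypothesis if $\mathbf u$ is a bubble, and to form the $m$ summands directly if
  $\mathbf w\cdot\mathbf u < 2D$.
\<close>

section \<open>Minkowski multiples\<close>

lemma minkowski_multiple_0: "minkowski_multiple 0 S = {0}"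
  by (auto simp: minkowski_multiple_def)

lemma minkowski_multiple_Suc:
  "minkowski_multiple (Suc m) S = {x + y | x y. x \<in> minkowski_multiple m S \<and> y \<in> S}"
proof (intro set_eqI iffI)
  fix z assume "z \<in> minkowski_multiple (Suc m) S"
  then obtain s where "z = (\<Sum>i<Suc m. s i)" "\<forall>i<Suc m. s i \<in> S"
    unfolding minkowski_multiple_def by auto
  moreover from this have "(\<Sum>i<m. s i) \<in> minkowski_multiple m S"
    unfolding minkowski_multiple_def by auto
  ultimately show "z \<in> {x + y | x y. x \<in> minkowski_multiple m S \<and> y \<in> S}"
    by auto
next
  fix z assume "z \<in> {x + y | x y. x \<in> minkowski_multiple m S \<and> y \<in> S}"
  then obtain s y where s: "\<forall>i<m. s i \<in> S" "y \<in> S" "z = (\<Sum>i<m. s i) + y"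
    unfolding minkowski_multiple_def by auto
  have "(\<Sum>i<Suc m. (s(m := y)) i) = (\<Sum>i<m. s i) + y"
    by simp
  then show "z \<in> minkowski_multiple (Suc m) S"
    unfolding minkowski_multiple_def using s
    by (auto intro!: exI[of _ "s(m := y)"] simp: less_Suc_eq)
qed

lemma minkowski_multiple_1: "minkowski_multiple (Suc 0) S = S"
  by (auto simp: minkowski_multiple_Suc minkowski_multiple_0)

lemma minkowski_multiple_add:
  "minkowski_multiple (a + b) S
    = {x + y | x y. x \<in> minkowski_multiple a S \<and> y \<in> minkowski_multiple b S}"
proof (induction b)
  case 0
  show ?case by (simp add: minkowski_multiple_0)
next
  case (Suc b)
  show ?case
    unfolding add_Suc_right minkowski_multiple_Suc Suc.IH
    by (auto simp: add.assoc) (metis add.assoc)+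
qed

lemma minkowski_multiple_addI:
  "x \<in> minkowski_multiple a S \<Longrightarrow> y \<in> minkowski_multiple b S \<Longrightarrow> x + y \<in> minkowski_multiple (a + b) S"
  by (auto simp: minkowski_multiple_add)

lemma minkowski_multiple_mono:
  "S \<subseteq> T \<Longrightarrow> minkowski_multiple m S \<subseteq> minkowski_multiple m T"
  unfolding minkowski_multiple_def by blast

lemma sum_in_minkowski_multiple:
  "(\<And>i. i < m \<Longrightarrow> s i \<in> S) \<Longrightarrow> (\<Sum>i<m. s i) \<in> minkowski_multiple m S"
  unfolding minkowski_multiple_def by blast


section \<open>Weights\<close>

lemma scalar_product_0: "scalar_product w 0 = 0"
  by (simp add: scalar_product_def)

lemma scalar_product_add:
  "scalar_product w (u + v) = scalar_product w u + scalar_product w v"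
  by (simp add: scalar_product_def distrib_left sum.distrib)

lemma scalar_product_sum:
  "scalar_product w (sum f A) = (\<Sum>i\<in>A. scalar_product w (f i))"
  by (induction A rule: infinite_finite_induct)
    (simp_all add: scalar_product_0 scalar_product_add)

lemma scalar_product_axis: "scalar_product w (axis i c) = w $ i * c"
  by (simp add: scalar_product_def axis_def if_distrib cong: if_cong)

lemma scalar_product_minkowski_V:
  "y \<in> minkowski_multiple s (V w d) \<Longrightarrow> scalar_product w y = s * d"
  by (auto simp: minkowski_multiple_def V_def scalar_product_sum)

lemma minkowski_V_plus_subset:
  "minkowski_multiple m (V_plus w d) \<subseteq> V_plus w (m * d)"
proof
  fix x assume "x \<in> minkowski_multiple m (V_plus w d)"
  then obtain s where s: "x = (\<Sum>i<m. s i)" "\<forall>i<m. d \<le> scalar_product w (s i)"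
    by (auto simp: minkowski_multiple_def V_plus_def)
  then have "(\<Sum>i<m. d) \<le> (\<Sum>i<m. scalar_product w (s i))"
    by (intro sum_mono) auto
  then show "x \<in> V_plus w (m * d)"
    by (simp add: V_plus_def s scalar_product_sum)
qed

lemma V_plus_add: "x \<in> V_plus w d \<Longrightarrow> x + y \<in> V_plus w d"
  by (simp add: V_plus_def scalar_product_add)

text \<open>\<open>V_plus\<close> is upward closed, so the last summand absorbs \<open>y\<close>.
  This lets every later argument discard surplus vectors; for \<open>m = 0\<close> there is no
  summand to take them.\<close>

lemma minkowski_V_plus_add:
  assumes "m \<ge> 1" "x \<in> minkowski_multiple m (V_plus w d)"
  shows "x + y \<in> minkowski_multiple m (V_plus w d)"
proof -
  obtain m' where m: "m = Suc m'" using assms(1) by (cases m) auto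
  then obtain a b where "x = a + b" "a \<in> minkowski_multiple m' (V_plus w d)" "b \<in> V_plus w d"
    using assms(2) by (auto simp: minkowski_multiple_Suc)
  then show ?thesis
    using V_plus_add[of b w d y] unfolding m minkowski_multiple_Suc
    by (auto simp: add.assoc)
qed

text \<open>Grouping the summands into \<open>m\<close> blocks of \<open>k\<close> gives blocks of
  weight at least \<open>k * d\<close>. It therefore suffices to produce \<open>m * k\<close>
  summands of weight \<open>d\<close>.\<close>

lemma minkowski_V_plus_group:
  "minkowski_multiple (m * k) (V_plus w d) \<subseteq> minkowski_multiple m (V_plus w (k * d))"
proof (induction m)
  case 0
  show ?case by (simp add: minkowski_multiple_0)
next
  case (Suc m)
  have eq: "Suc m * k = m * k + k" by simp
  show ?case
    unfolding eq minkowski_multiple_add minkowski_multiple_Suc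
    using Suc.IH minkowski_V_plus_subset[of k w d] by blast
qed

section \<open>Decomposition of vectors into standard basis vectors\<close>

lemma nat_vec_induct [case_names zero add_axis]:
  fixes v :: "nat ^ 'n"
  assumes "P 0" "\<And>v i. P v \<Longrightarrow> P (v + axis i 1)"
  shows "P v"
proof (induction "\<Sum>i\<in>UNIV. v $ i" arbitrary: v)
  case 0
  then have "v = 0" by (simp add: vec_eq_iff)
  then show ?case using assms(1) by simp
next
  case (Suc n)
  then obtain i where i: "v $ i > 0"
    by (metis finite not_gr_zero sum_eq_0_iff Zero_not_Suc)
  define v' where "v' = (\<chi> j. if j = i then v $ j - 1 else v $ j)"
  have v: "v = v' + axis i 1"
    using i by (auto simp: vec_eq_iff v'_def axis_def)
  have "Suc n = (\<Sum>j\<in>UNIV. v' $ j) + 1"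
    unfolding Suc.hyps(2) unfolding v by (simp add: sum.distrib axis_def)
  then have "P v'" using Suc.hyps(1)[of v'] by simp
  then show ?case using assms(2) v by simp
qed

text \<open>Turns a vector into the items of a bin covering problem. A multiset of vectors is used
  because items repeat and will later be merged into sums of basis vectors.\<close>

lemma ex_mset_axis:
  fixes v :: "nat ^ 'n"
  shows "\<exists>M. sum_mset M = v \<and> (\<forall>x\<in>#M. \<exists>i. x = axis i 1)"
proof (induction v rule: nat_vec_induct)
  case zero
  show ?case by (rule exI[of _ "{#}"]) simp
next
  case (add_axis v i)
  then obtain M where "sum_mset M = v" "\<forall>x\<in>#M. \<exists>i. x = axis i 1" by blast
  then show ?case by (intro exI[of _ "add_mset (axis i 1) M"]) (auto simp: add.commute)
qed


section \<open>Covering bins with unit fractions\<close>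

lemma ex_submset_size:
  assumes "n \<le> size M"
  shows "\<exists>K. K \<subseteq># M \<and> size K = n"
proof -
  obtain xs where xs: "M = mset xs" by (metis ex_mset)
  have "mset (take n xs) \<subseteq># M"
    unfolding xs using mset_subset_eq_add_left[of "mset (take n xs)" "mset (drop n xs)"]
    by (simp flip: mset_append)
  moreover have "size (mset (take n xs)) = n" using assms xs by simp
  ultimately show ?thesis by blast
qed

text \<open>Each item weighs \<open>D / c\<close>; multiplying by \<open>c\<close> keeps the
  statement in the natural numbers.\<close>

lemma scalar_product_sum_mset:
  assumes "\<And>x. x \<in># M \<Longrightarrow> c * scalar_product w x = (D::nat)"
  shows "c * scalar_product w (sum_mset M) = size M * D"
  using assms by (induction M) (auto simp: scalar_product_0 scalar_product_add distrib_left)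

text \<open>Greedy filling: a small item always goes into a bin that is still below
  \<open>D\<close>. Such a bin ends at most at \<open>D + D/(2m)\<close>, so the upper bound on the
  bins is an invariant, and so is the total weight. All inequalities are cleared of
  denominators.\<close>

lemma fill_bins:
  fixes w :: "nat ^ 'n" and b :: "nat \<Rightarrow> nat ^ 'n"
  assumes "m \<ge> 1"
    and "\<And>x. x \<in># Y \<Longrightarrow> 2 * m * scalar_product w x \<le> D"
    and "\<And>j. j < m \<Longrightarrow> 2 * m * scalar_product w (b j) \<le> (2 * m + 1) * D"
    and "(2 * m + 1) * D \<le> 2 * scalar_product w ((\<Sum>j<m. b j) + sum_mset Y)"
  shows "(\<Sum>j<m. b j) + sum_mset Y \<in> minkowski_multiple m (V_plus w D)"
proof (cases "\<forall>j<m. b j \<in> V_plus w D")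
  case True
  then show ?thesis
    using assms(1) by (intro minkowski_V_plus_add sum_in_minkowski_multiple) auto
next
  case False
  then obtain j where j: "j < m" "scalar_product w (b j) < D"
    by (auto simp: V_plus_def)
  show ?thesis
    using assms(2-4) j
  \<comment> \<open>\<open>j\<close> is some bin that is still underfull. It may change after each
    item, as do the contents \<open>b\<close>.\<close>
  proof (induction Y arbitrary: b j)
    case empty
    \<comment> \<open>With all items placed and bin \<open>j\<close> below \<open>D\<close>, the
      total is less than \<open>(m - 1) (D + D/(2m)) + D\<close>, which is below
      \<open>(m + 1/2) D\<close>: a contradiction.\<close>
    have "2 * m * scalar_product w (\<Sum>i<m. b i) = (\<Sum>i<m. 2 * m * scalar_product w (b i))"
      by (simp add: scalar_product_sum sum_distrib_left)
    also have "\<dots> = (\<Sum>i\<in>{..<m}-{j}. 2 * m * scalar_product w (b i)) + 2 * m * scalar_product w (b j)"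
      using empty.prems(4) by (simp add: sum.remove[of _ j])
    also have "\<dots> < (\<Sum>i\<in>{..<m}-{j}. (2 * m + 1) * D) + 2 * m * D"
      using empty.prems assms(1) by (intro add_le_less_mono sum_mono) auto
    also have "\<dots> = (m - 1) * ((2 * m + 1) * D) + 2 * m * D"
      using empty.prems(4) by simp
    also have "\<dots> \<le> m * ((2 * m + 1) * D)"
      using assms(1) by (cases m) (auto simp: algebra_simps)
    finally show ?case using empty.prems(3) by (simp add: mult.assoc)
  next
    case (add x Y)
    let ?b = "b(j := b j + x)"
    have s: "(\<Sum>i<m. ?b i) = (\<Sum>i<m. b i) + x"
      using \<open>j < m\<close> by (simp add: sum.remove[of _ j] ac_simps)
    have total: "(\<Sum>i<m. b i) + sum_mset (add_mset x Y) = (\<Sum>i<m. ?b i) + sum_mset Y"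
      unfolding s by (simp add: ac_simps)
    have bound: "2 * m * scalar_product w (?b i) \<le> (2 * m + 1) * D" if "i < m" for i
    proof (cases "i = j")
      case True
      have "2 * m * scalar_product w (b j) \<le> 2 * m * D"
        using \<open>scalar_product w (b j) < D\<close> by (intro mult_le_mono2) simp
      moreover have "2 * m * scalar_product w x \<le> D" using add.prems(1) by simp
      ultimately have "2 * m * scalar_product w (b j) + 2 * m * scalar_product w x \<le> 2 * m * D + D"
        by (rule add_mono)
      then show ?thesis
        using True by (simp only: fun_upd_same scalar_product_add distrib_left distrib_right mult_1)
    next
      case False
      then show ?thesis using add.prems(2) that by simp
    qed
    have weight: "(2 * m + 1) * D \<le> 2 * scalar_product w ((\<Sum>i<m. ?b i) + sum_mset Y)"
      using add.prems(3) unfolding total .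
    have small: "2 * m * scalar_product w y \<le> D" if "y \<in># Y" for y
      using add.prems(1) that by simp
    show ?case unfolding total
    proof (cases "\<forall>i<m. ?b i \<in> V_plus w D")
      case True
      then show "(\<Sum>i<m. ?b i) + sum_mset Y \<in> minkowski_multiple m (V_plus w D)"
        using assms(1) by (intro minkowski_V_plus_add sum_in_minkowski_multiple) auto
    next
      case False
      then obtain i where i: "i < m" "scalar_product w (?b i) < D"
        by (auto simp: V_plus_def)
      show "(\<Sum>i<m. ?b i) + sum_mset Y \<in> minkowski_multiple m (V_plus w D)"
        using small bound weight i by (rule add.IH)
    qed
  qed
qed

text \<open>Class \<open>j\<close> is the intended initial content of bin \<open>j\<close>, and the
  last part holds the small items. Positivity of \<open>q\<close> guarantees that no item is
  lost.\<close>

lemma mset_split_by_key: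
  assumes "\<And>x. x \<in># M \<Longrightarrow> (q x :: nat) > 0"
  shows "M = (\<Sum>j<m. filter_mset (\<lambda>x. q x = 2 * j + 1 \<or> q x = 2 * j + 2) M)
    + filter_mset (\<lambda>x. q x > 2 * m) M"
proof (induction m)
  case 0
  have "filter_mset (\<lambda>x. q x > 0) M = filter_mset (\<lambda>_. True) M"
    using assms by (intro filter_mset_cong) auto
  then show ?case by simp
next
  case (Suc m)
  have "filter_mset (\<lambda>x. q x > 2 * m) M
      = filter_mset (\<lambda>x. q x = 2 * m + 1 \<or> q x = 2 * m + 2) M + filter_mset (\<lambda>x. q x > 2 * Suc m) M"
    by (rule multiset_eqI) auto
  with Suc show ?case by (simp add: add.assoc)
qed

lemma sum_mset_sum: "sum_mset (\<Sum>j\<in>A. F j) = (\<Sum>j\<in>A. sum_mset (F j))"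
  by (induction A rule: infinite_finite_induct) auto

text \<open>
  Two items of weight $D/q$ with $q$ even are merged into one of weight $D/(q/2)$, and $q$ items of
  weight $D/q$ fill a bin exactly. Once neither step applies, there are at most $q - 1$ items of
  weight $D/q$, and at most one if $q$ is even. Bin $j$ can then take all items with
  $q \in \{2j+1, 2j+2\}$, since $\frac{2j}{2j+1} + \frac1{2j+2} < 1$. The remaining items have
  $q > 2m$, and filling up with them exceeds the capacity of a bin by at most $D/2m$.
\<close>

lemma cover_bins:
  fixes w :: "nat ^ 'n" and M :: "(nat ^ 'n) multiset"
  assumes "D > 0" "m \<ge> 1"
    and "\<And>x. x \<in># M \<Longrightarrow> scalar_product w x dvd D"
    and "(2 * m + 1) * D \<le> 2 * scalar_product w (sum_mset M)"
  shows "sum_mset M \<in> minkowski_multiple m (V_plus w D)"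
  using assms
proof (induction "size M" arbitrary: M m rule: less_induct)
  case less
  \<comment> \<open>The weight of \<open>x\<close> is the unit fraction
    \<open>D / q x\<close>.\<close>
  define q where "q x = D div scalar_product w x" for x
  have q: "q x * scalar_product w x = D" if "x \<in># M" for x
    using less.prems(3)[OF that] by (simp add: q_def)
  have q_pos: "q x > 0" if "x \<in># M" for x
    using q[OF that] less.prems(1) by (cases "q x") auto
  \<comment> \<open>The first two cases lead to a multiset with fewer items, which is what the
    induction on \<open>size M\<close> needs.\<close>
  consider (merge) x y N where "M = add_mset x (add_mset y N)" "q x = q y" "even (q x)"
    | (remove) c K N where "M = K + N" "c > 0" "\<forall>x\<in>#K. q x = c" "size K = c"
    | (reduced) "\<And>c. even c \<Longrightarrow> size (filter_mset (\<lambda>x. q x = c) M) \<le> 1"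
        "\<And>c. c > 0 \<Longrightarrow> size (filter_mset (\<lambda>x. q x = c) M) < c"
  proof -
    have ex: "\<exists>K N. M = K + N \<and> (\<forall>x\<in>#K. q x = c) \<and> size K = n"
      if le: "n \<le> size (filter_mset (\<lambda>x. q x = c) M)" for c n
    proof -
      obtain K where K: "K \<subseteq># filter_mset (\<lambda>x. q x = c) M" "size K = n"
        using ex_submset_size[OF le] by blast
      have "K \<subseteq># M" using K(1) multiset_filter_subset subset_mset.order_trans by blast
      then have "M = K + (M - K)" by simp
      moreover have "\<forall>x\<in>#K. q x = c" using mset_subset_eqD[OF K(1)] by auto
      ultimately show ?thesis using K(2) by (intro exI conjI)
    qed
    show ?thesis
    proof (cases "\<exists>c. even c \<and> size (filter_mset (\<lambda>x. q x = c) M) \<ge> 2")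
      case True
      then obtain c where "even c" and large: "2 \<le> size (filter_mset (\<lambda>x. q x = c) M)" by blast
      from ex[OF large] obtain K N where c: "M = K + N" "\<forall>x\<in>#K. q x = c" "size K = 2"
        by (elim exE conjE)
      then obtain x K' where "K = add_mset x K'" "size K' = 1"
        using size_eq_Suc_imp_eq_union[of K 1] c(3) by auto
      then obtain y where "K = {#x, y#}"
        using size_1_singleton_mset[of K'] by blast
      have "M = add_mset x (add_mset y N)" "q x = q y" "even (q x)"
        using c \<open>K = {#x, y#}\<close> \<open>even c\<close> by simp_all
      then show ?thesis by (rule merge)
    next
      case few: False
      show ?thesis
      proof (cases "\<exists>c>0. size (filter_mset (\<lambda>x. q x = c) M) \<ge> c")
        case True
        then obtain c where c: "c > 0" "c \<le> size (filter_mset (\<lambda>x. q x = c) M)" by blast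
        from ex[OF c(2)] obtain K N where "M = K + N" "\<forall>x\<in>#K. q x = c" "size K = c"
          by (elim exE conjE)
        then show ?thesis using c(1) by (intro remove)
      next
        case False
        show ?thesis
        proof (rule reduced)
          show "size (filter_mset (\<lambda>x. q x = c) M) \<le> 1" if "even c" for c
            using few that by (metis not_less_eq_eq numeral_2_eq_2 One_nat_def)
          show "size (filter_mset (\<lambda>x. q x = c) M) < c" if "c > 0" for c
            using False that by (metis not_le)
        qed
      qed
    qed
  qed
  then show ?case
  proof cases
    case merge
    have xy: "scalar_product w x = scalar_product w y"
    proof -
      have "q x * scalar_product w x = q x * scalar_product w y"
        using q[of x] q[of y] merge by simp
      then show ?thesis using q_pos[of x] merge(1) by simp
    qed
    \<comment> \<open>The merged item has weight \<open>D / h\<close>, so its weight divides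
      \<open>D\<close> again.\<close>
    obtain h where h: "q x = 2 * h" using merge(3) by blast
    have "scalar_product w (x + y) * h = D"
      using q[of x] merge(1) h xy by (simp add: scalar_product_add algebra_simps)
    then have "scalar_product w (x + y) dvd D" by (metis dvd_triv_left)
    then have "sum_mset (add_mset (x + y) N) \<in> minkowski_multiple m (V_plus w D)"
      using less.prems merge(1) by (intro less.hyps) (auto simp: ac_simps)
    then show ?thesis using merge(1) by (simp add: ac_simps)
  next
    case remove
    have "c * scalar_product w (sum_mset K) = size K * D"
    proof (rule scalar_product_sum_mset)
      show "c * scalar_product w x = D" if "x \<in># K" for x
        using q[of x] remove(1,3) that by auto
    qed
    then have K: "scalar_product w (sum_mset K) = D" using remove by simp
    show ?thesis
    \<comment> \<open>The induction hypothesis requires at least one remaining bin. For a single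
      bin, \<open>K\<close> already suffices and \<open>N\<close> is surplus.\<close>
    proof (cases "m = 1")
      case True
      then show ?thesis
        using K remove(1)
        by (simp add: minkowski_multiple_1 V_plus_def scalar_product_add)
    next
      case False
      then obtain m' where m: "m = m' + Suc 0" "m' \<ge> 1"
        using less.prems(2) by (cases m) auto
      have "sum_mset N \<in> minkowski_multiple m' (V_plus w D)"
      proof (rule less.hyps)
        show "size N < size M" using remove by simp
        show "(2 * m' + 1) * D \<le> 2 * scalar_product w (sum_mset N)"
          using less.prems(4) K remove(1) m(1) by (simp add: scalar_product_add algebra_simps)
      qed (use less.prems remove m in auto)
      moreover have "sum_mset K \<in> minkowski_multiple (Suc 0) (V_plus w D)"
        by (simp add: minkowski_multiple_1 V_plus_def K)
      ultimately have "sum_mset N + sum_mset K \<in> minkowski_multiple m (V_plus w D)"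
        unfolding m(1) by (rule minkowski_multiple_addI)
      then show ?thesis using remove(1) by (simp add: add.commute)
    qed
  next
    case reduced
    define F where "F c = filter_mset (\<lambda>x. q x = c) M" for c
    define B where "B j = filter_mset (\<lambda>x. q x = 2 * j + 1 \<or> q x = 2 * j + 2) M" for j
    define Y where "Y = filter_mset (\<lambda>x. q x > 2 * m) M"
    have wF: "c * scalar_product w (sum_mset (F c)) = size (F c) * D" for c
      by (rule scalar_product_sum_mset) (use q in \<open>auto simp: F_def\<close>)
    have wB: "scalar_product w (sum_mset (B j)) \<le> D" for j
    proof -
      let ?a = "scalar_product w (sum_mset (F (2 * j + 1)))"
      let ?b = "scalar_product w (sum_mset (F (2 * j + 2)))"
      have "B j = F (2 * j + 1) + F (2 * j + 2)"
        unfolding B_def F_def by (rule multiset_eqI) auto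
      then have sum: "scalar_product w (sum_mset (B j)) = ?a + ?b"
        by (simp add: scalar_product_add)
      have "size (F (2 * j + 1)) \<le> 2 * j" "size (F (2 * j + 2)) \<le> 1"
        using reduced(2)[of "2 * j + 1"] reduced(1)[of "2 * j + 2"] by (simp_all add: F_def)
      then have "size (F (2 * j + 1)) * D \<le> 2 * j * D" "size (F (2 * j + 2)) * D \<le> 1 * D"
        by (blast intro: mult_le_mono1)+
      then have "(2 * j + 1) * ?a \<le> 2 * j * D" "(2 * j + 2) * ?b \<le> D"
        by (simp_all only: wF mult_1)
      \<comment> \<open>Uses \<open>(2 * j + 1) * ?b \<le> (2 * j + 2) * ?b \<le> D\<close>.\<close>
      then have "(2 * j + 1) * (?a + ?b) \<le> (2 * j + 1) * D"
        by (simp add: algebra_simps)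
      then show ?thesis unfolding sum by (simp only: mult_le_cancel1)
    qed
    have M: "sum_mset M = (\<Sum>j<m. sum_mset (B j)) + sum_mset Y"
    proof -
      have "M = (\<Sum>j<m. B j) + Y"
        unfolding B_def Y_def by (rule mset_split_by_key) (rule q_pos)
      then have "sum_mset M = sum_mset ((\<Sum>j<m. B j) + Y)" by (rule arg_cong)
      then show ?thesis by (simp only: sum_mset_sum sum_mset.union)
    qed
    show ?thesis unfolding M
    proof (rule fill_bins)
      show "2 * m * scalar_product w x \<le> D" if "x \<in># Y" for x
      proof -
        have "2 * m * scalar_product w x \<le> q x * scalar_product w x"
          using that by (intro mult_le_mono1) (simp add: Y_def)
        also have "\<dots> = D" using q that by (simp add: Y_def)
        finally show ?thesis .
      qed
      show "2 * m * scalar_product w (sum_mset (B j)) \<le> (2 * m + 1) * D" for j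
        by (rule mult_le_mono) (simp_all add: wB)
    qed (use less.prems M in auto)
  qed
qed


section \<open>Generation in degree one as a condition on exponents\<close>

text \<open>A polynomial is the finite sum of its terms, so membership in an additive subgroup can
  be checked term by term.\<close>

lemma poly_mapping_mem_of_singles:
  fixes p :: "'a \<Rightarrow>\<^sub>0 'b::ab_group_add"
  assumes "group_closure A = A"
    and "\<And>e. e \<in> Poly_Mapping.keys p \<Longrightarrow> Poly_Mapping.single e (Poly_Mapping.lookup p e) \<in> A"
  shows "p \<in> A"
proof -
  let ?f = "\<lambda>e. Poly_Mapping.single e (Poly_Mapping.lookup p e)"
  have "Poly_Mapping.lookup (sum ?f I) e = (if e \<in> I then Poly_Mapping.lookup p e else 0)"
    if "finite I" for I e
    using that by (induction I rule: finite_induct) (auto simp: lookup_single lookup_add when_def)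
  then have "sum ?f (Poly_Mapping.keys p) = p"
    by (intro poly_mapping_eqI) (simp add: in_keys_iff)
  moreover have "sum ?f I \<in> A" if "I \<subseteq> Poly_Mapping.keys p" for I
    using that
  proof (induction I rule: infinite_finite_induct)
    case (insert e I)
    then show ?case
      using group_closure_add[of "?f e" A "sum ?f I"] assms by simp
  qed (use assms(1) zero_in_group_closure[of A] in auto)
  ultimately show ?thesis by (metis order_refl)
qed

lemma keys_diff_subset:
  "Poly_Mapping.keys a \<subseteq> K \<Longrightarrow> Poly_Mapping.keys b \<subseteq> K \<Longrightarrow> Poly_Mapping.keys (a - b) \<subseteq> K"
  using keys_diff[of a b] by blast

lemma monomial_in_rees_ring:
  fixes w :: "nat ^ 'n"
  assumes "d \<le> scalar_product w v"
  shows "monomial_tx d v \<in> (rees_ring w :: ('q::comm_ring_1, 'n) tx_poly set)"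
  using assms
proof (induction v arbitrary: d rule: nat_vec_induct)
  case zero
  then have one: "(monomial_tx d 0 :: ('q, 'n) tx_poly) = 1"
    by (simp add: scalar_product_0 monomial_tx_def flip: zero_prod_def)
  show ?case unfolding one rees_ring_def by (rule ring_closure.one)
next
  case (add_axis v i)
  let ?R = "rees_ring w :: ('q, 'n) tx_poly set"
  \<comment> \<open>The split-off factor \<open>x_i\<close> carries as much of \<open>t^d\<close> as
    its generator allows. What remains is either \<open>0\<close> or \<open>d - w $ i\<close>,
    within the bound for \<open>v\<close> in both cases.\<close>
  define d1 where "d1 = min d (w $ i)"
  have le: "d - d1 \<le> scalar_product w v"
    using add_axis.prems by (auto simp: d1_def scalar_product_add scalar_product_axis)
  have "monomial_tx d1 (axis i 1) \<in> ?R"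
    unfolding rees_ring_def d1_def by (rule ring_closure.base) (blast intro: min.cobounded2)
  then have "monomial_tx (d - d1) v * monomial_tx d1 (axis i 1) \<in> ?R"
    using add_axis.IH[OF le] unfolding rees_ring_def by (intro ring_closure.mult)
  moreover have "monomial_tx (d - d1) v * monomial_tx d1 (axis i 1)
      = (monomial_tx d (v + axis i 1) :: ('q, 'n) tx_poly)"
    by (simp add: monomial_tx_def mult_single d1_def)
  ultimately show ?case by simp
qed

text \<open>The exponents satisfying the inequality form a submonoid containing those of the
  generators. Conversely, each term is a constant times a monomial already known to lie in the
  ring.\<close>

lemma rees_ring_iff:
  "p \<in> rees_ring w \<longleftrightarrow> (\<forall>e\<in>Poly_Mapping.keys p. fst e \<le> scalar_product w (snd e))"
proof
  assume "p \<in> rees_ring w"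
  then show "\<forall>e\<in>Poly_Mapping.keys p. fst e \<le> scalar_product w (snd e)"
    unfolding rees_ring_def
  proof (induction rule: ring_closure.induct)
    case one
    show ?case by simp
  next
    case (base s)
    then show ?case
      by (auto simp: const_tx_def monomial_tx_def scalar_product_axis zero_prod_def split: if_splits)
  next
    case (diff s t)
    then show ?case using keys_diff[of s t] by blast
  next
    case (mult s t)
    show ?case
    proof
      fix e assume "e \<in> Poly_Mapping.keys (s * t)"
      then obtain a b where "e = a + b" "a \<in> Poly_Mapping.keys s" "b \<in> Poly_Mapping.keys t"
        using keys_mult[of s t] by blast
      then show "fst e \<le> scalar_product w (snd e)"
        using mult.IH by (simp add: scalar_product_add add_mono)
    qed
  qed
next
  assume p: "\<forall>e\<in>Poly_Mapping.keys p. fst e \<le> scalar_product w (snd e)"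
  show "p \<in> rees_ring w"
  proof (rule poly_mapping_mem_of_singles)
    show "group_closure (rees_ring w) = rees_ring w"
      unfolding rees_ring_def
      by (rule group_closure_eqI) (auto intro: ring_closure_zero ring_closure.diff)
  next
    fix e assume "e \<in> Poly_Mapping.keys p"
    then have "monomial_tx (fst e) (snd e) \<in> rees_ring w"
      using p by (intro monomial_in_rees_ring) auto
    moreover have "const_tx (Poly_Mapping.lookup p e) \<in> rees_ring w"
      unfolding rees_ring_def by (rule ring_closure.base) simp
    ultimately have "const_tx (Poly_Mapping.lookup p e) * monomial_tx (fst e) (snd e) \<in> rees_ring w"
      unfolding rees_ring_def by (intro ring_closure.mult)
    then show "Poly_Mapping.single e (Poly_Mapping.lookup p e) \<in> rees_ring w"
      by (simp add: const_tx_def monomial_tx_def mult_single)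
  qed
qed

lemma rees_component_iff:
  "p \<in> rees_component w d \<longleftrightarrow> Poly_Mapping.keys p \<subseteq> {d} \<times> V_plus w d"
  by (force simp: rees_component_def rees_ring_iff V_plus_def)

section \<open>Supports of products and of powers of graded components\<close>

lemma keys_prod_subset:
  fixes f :: "nat \<Rightarrow> ('q::comm_ring_1, 'n::finite) tx_poly"
  assumes "\<And>i. i < m \<Longrightarrow> Poly_Mapping.keys (f i) \<subseteq> {d} \<times> S"
  shows "Poly_Mapping.keys (\<Prod>i<m. f i) \<subseteq> {m * d} \<times> minkowski_multiple m S"
  using assms
proof (induction m)
  case 0
  show ?case by (simp add: minkowski_multiple_0 zero_prod_def)
next
  case (Suc m)
  show ?case
  proof
    fix e assume "e \<in> Poly_Mapping.keys (\<Prod>i<Suc m. f i)"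
    then obtain a b where "e = a + b" "a \<in> Poly_Mapping.keys (\<Prod>i<m. f i)" "b \<in> Poly_Mapping.keys (f m)"
      using keys_mult[of "\<Prod>i<m. f i" "f m"] by auto
    moreover have "a \<in> {m * d} \<times> minkowski_multiple m S" "b \<in> {d} \<times> S"
      using calculation Suc.IH Suc.prems by (blast intro: less_SucI)+
    ultimately show "e \<in> {Suc m * d} \<times> minkowski_multiple (Suc m) S"
      unfolding minkowski_multiple_Suc by auto blast
  qed
qed

lemma prod_single:
  fixes e :: "nat \<Rightarrow> 'a::comm_monoid_add" and c :: "nat \<Rightarrow> 'q::comm_semiring_1"
  shows "(\<Prod>i<m. Poly_Mapping.single (e i) (c i)) = Poly_Mapping.single (\<Sum>i<m. e i) (\<Prod>i<m. c i)"
  by (induction m) (simp_all add: mult_single)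

text \<open>Exponents add under multiplication, which bounds the support. Conversely, a
  decomposition of an exponent into \<open>m\<close> summands factors the corresponding
  term.\<close>

lemma power_subgroup_rees_component_iff:
  fixes p :: "('q::comm_ring_1, 'n::finite) tx_poly"
  assumes "m \<ge> 1"
  shows "p \<in> power_subgroup (rees_component w d) m
    \<longleftrightarrow> Poly_Mapping.keys p \<subseteq> {m * d} \<times> minkowski_multiple m (V_plus w d)"
proof
  assume "p \<in> power_subgroup (rees_component w d) m"
  then show "Poly_Mapping.keys p \<subseteq> {m * d} \<times> minkowski_multiple m (V_plus w d)"
    unfolding power_subgroup_def
  proof (induction rule: group_closure.induct)
    case (base s)
    then consider "s = 0"
      | f where "s = (\<Prod>i<m. f i)" "\<forall>i<m. f i \<in> rees_component w d"
      by auto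
    then show ?case
    proof cases
      case 2
      then show ?thesis
        by (simp add: keys_prod_subset flip: rees_component_iff)
    qed simp
  next
    case (diff s t)
    then show ?case by (intro keys_diff_subset)
  qed
next
  assume p: "Poly_Mapping.keys p \<subseteq> {m * d} \<times> minkowski_multiple m (V_plus w d)"
  show "p \<in> power_subgroup (rees_component w d) m"
  proof (rule poly_mapping_mem_of_singles)
    show "group_closure (power_subgroup (rees_component w d) m) = power_subgroup (rees_component w d) m"
      unfolding power_subgroup_def by (rule group_closure_eqI) (auto intro: group_closure.diff)
  next
    fix e assume "e \<in> Poly_Mapping.keys p"
    then obtain v where e: "e = (m * d, v)" "v \<in> minkowski_multiple m (V_plus w d)"
      using p by auto
    then obtain s where s: "v = (\<Sum>i<m. s i)" "\<forall>i<m. s i \<in> V_plus w d"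
      by (auto simp: minkowski_multiple_def)
    define c where "c = Poly_Mapping.lookup p e"
    \<comment> \<open>The whole coefficient goes to factor \<open>0\<close>, which exists because
      \<open>m \<ge> 1\<close>.\<close>
    define f where "f i = Poly_Mapping.single (d, s i) (if i = 0 then c else 1)" for i :: nat
    have "(\<Sum>i<n. (d, s i)) = (n * d, \<Sum>i<n. s i)" for n
      by (induction n) (simp_all add: zero_prod_def)
    moreover have "(\<Prod>i<m. if i = 0 then c else 1) = c"
      using assms by (cases m) (simp_all add: prod.lessThan_Suc_shift del: prod.lessThan_Suc)
    ultimately have "Poly_Mapping.single e c = (\<Prod>i<m. f i)"
      unfolding f_def by (simp add: prod_single e(1) s(1))
    moreover have "\<forall>i<m. f i \<in> rees_component w d"
      using s(2) by (auto simp: rees_component_iff f_def)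
    ultimately show "Poly_Mapping.single e (Poly_Mapping.lookup p e) \<in> power_subgroup (rees_component w d) m"
      unfolding power_subgroup_def c_def by (intro group_closure.base) auto
  qed
qed

text \<open>All groups involved are determined by supports, so the coefficient ring disappears and
  only exponents are compared.\<close>

lemma generated_in_degree_1_rees_iff:
  fixes w :: "nat ^ 'n"
  assumes "d > 0"
  shows "generated_in_degree_1
      (veronese d (rees_component w :: nat \<Rightarrow> ('q::comm_ring_1, 'n) tx_poly set))
      (veronese_component d (rees_component w))
    \<longleftrightarrow> (\<forall>m\<ge>1. V_plus w (m * d) \<subseteq> minkowski_multiple m (V_plus w d))"
    (is "generated_in_degree_1 ?S ?A \<longleftrightarrow> ?R")
proof
  let ?B = "\<lambda>m. if m = 0 then ?A 0 else power_subgroup (?A 1) m"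
  assume "generated_in_degree_1 ?S ?A"
  then have S: "?S = sum_subgroups ?B"
    by (simp add: generated_in_degree_1_def is_direct_sum_def)
  \<comment> \<open>\<open>K\<close> bounds the supports in the sum of the powers.
    \<open>UNIV\<close> is a harmless bound in degree \<open>0\<close>, as only
    \<open>m \<ge> 1\<close> is read off below.\<close>
  define K where "K = (\<Union>m. {m * d} \<times> (if m = 0 then UNIV else minkowski_multiple m (V_plus w d)))"
  have keys: "Poly_Mapping.keys p \<subseteq> K" if "p \<in> sum_subgroups ?B" for p
    using that unfolding sum_subgroups_def
  proof (induction rule: group_closure.induct)
    case (base s)
    then consider "s = 0" | m where "s \<in> ?B m" by blast
    then show ?case
    proof cases
      case 2
      then have "Poly_Mapping.keys s
          \<subseteq> {m * d} \<times> (if m = 0 then UNIV else minkowski_multiple m (V_plus w d))"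
        using power_subgroup_rees_component_iff[of m s w d] rees_component_iff[of s w 0]
        by (auto simp: veronese_component_def split: if_splits)
      then show ?thesis unfolding K_def by blast
    qed simp
  next
    case (diff s t)
    then show ?case by (intro keys_diff_subset)
  qed
  show ?R
  proof (intro allI impI subsetI)
    fix m :: nat and v assume m: "m \<ge> 1" and v: "v \<in> V_plus w (m * d)"
    have "(monomial_tx (m * d) v :: ('q, 'n) tx_poly) \<in> ?A m"
      using v by (simp add: veronese_component_def rees_component_iff monomial_tx_def mult.commute)
    then have "(monomial_tx (m * d) v :: ('q, 'n) tx_poly) \<in> ?S"
      unfolding veronese_def sum_subgroups_def by (intro group_closure.base) blast
    \<comment> \<open>The exponent does occur in the monomial because \<open>1 \<noteq> 0\<close> in
      the coefficients. As \<open>d > 0\<close>, the degree \<open>m * d\<close> then singles out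
      the right member of the union.\<close>
    then have "(m * d, v) \<in> K"
      using keys S by (force simp: monomial_tx_def)
    then show "v \<in> minkowski_multiple m (V_plus w d)"
      using m assms by (auto simp: K_def split: if_splits)
  qed
next
  let ?B = "\<lambda>m. if m = 0 then ?A 0 else power_subgroup (?A 1) m"
  assume R: ?R
  have "?B m = ?A m" for m
  proof (cases "m = 0")
    case False
    then have "minkowski_multiple m (V_plus w d) = V_plus w (m * d)"
      using R minkowski_V_plus_subset by (metis One_nat_def Suc_leI not_gr_zero subset_antisym)
    then have "p \<in> power_subgroup (?A 1) m \<longleftrightarrow> p \<in> ?A m" for p
      using False power_subgroup_rees_component_iff[of m p w d]
      by (simp add: veronese_component_def rees_component_iff mult.commute)
    then show ?thesis using False by auto
  qed simp
  \<comment> \<open>With equal components, directness is inherited from the grading of the Veronese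
    subring.\<close>
  then have "?B = ?A" by blast
  moreover have "is_direct_sum ?S ?A"
    using graded_ring_veronese[OF assms, of w, where 'q = 'q] by (simp add: graded_ring_def)
  ultimately show "generated_in_degree_1 ?S ?A"
    unfolding generated_in_degree_1_def by simp
qed


section \<open>Bubbles\<close>

lemma lcm_weight_pos:
  fixes w :: "nat ^ 'n"
  assumes "\<forall>i. w $ i \<ge> 1"
  shows "lcm_weight w > 0"
proof -
  have "0 \<notin> range (\<lambda>i. w $ i)" using assms by (metis imageE not_one_le_zero)
  then have "lcm_weight w \<noteq> 0" by (simp add: lcm_weight_def)
  then show ?thesis by blast
qed

text \<open>Covers \<open>m * k\<close> bins of capacity \<open>D = lcm_weight w\<close> by basis
  vectors, whose weights divide \<open>D\<close>, and groups the bins. Covering needs a surplus of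
  \<open>D/2\<close>; here a full \<open>D\<close> is available.\<close>

lemma V_plus_subset_minkowski:
  fixes w :: "nat ^ 'n"
  assumes w: "\<forall>i. w $ i \<ge> 1" and "m \<ge> 1" "k \<ge> 1"
  shows "V_plus w ((m * k + 1) * lcm_weight w)
    \<subseteq> minkowski_multiple m (V_plus w (k * lcm_weight w))"
proof
  fix v assume v: "v \<in> V_plus w ((m * k + 1) * lcm_weight w)"
  obtain M where M: "sum_mset M = v" "\<forall>x\<in>#M. \<exists>i. x = axis i 1"
    using ex_mset_axis by blast
  have "sum_mset M \<in> minkowski_multiple (m * k) (V_plus w (lcm_weight w))"
  proof (rule cover_bins)
    show "scalar_product w x dvd lcm_weight w" if "x \<in># M" for x
    proof -
      obtain i where "x = axis i 1" using M(2) \<open>x \<in># M\<close> by blast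
      then show ?thesis by (simp add: scalar_product_axis lcm_weight_def dvd_Lcm)
    qed
  qed (use v M(1) assms lcm_weight_pos[OF w] in \<open>auto simp: V_plus_def algebra_simps\<close>)
  then show "v \<in> minkowski_multiple m (V_plus w (k * lcm_weight w))"
    using M(1) minkowski_V_plus_group by blast
qed

text \<open>Subtracting a vector of weight \<open>d > 0\<close> lowers the weight, so the process
  stops; \<open>s\<close> counts the subtractions.\<close>

lemma split_off_V:
  fixes v :: "nat ^ 'n"
  assumes "d > 0"
  shows "\<exists>u y s. v = u + y \<and> y \<in> minkowski_multiple s (V w d)
    \<and> \<not> (\<exists>x. scalar_product w x = d \<and> x \<le> u)"
proof (induction "scalar_product w v" arbitrary: v rule: less_induct)
  case less
  show ?case
  proof (cases "\<exists>x. scalar_product w x = d \<and> x \<le> v")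
    case False
    then show ?thesis
      by (intro exI[of _ v] exI[of _ 0]) (simp add: minkowski_multiple_0)
  next
    case True
    then obtain x where x: "scalar_product w x = d" "x \<le> v" by blast
    obtain z where v: "v = z + x"
    proof
      show "v = (v - x) + x" using x(2) by (simp add: vec_eq_iff less_eq_vec_def)
    qed
    then have "scalar_product w z < scalar_product w v"
      using x(1) assms by (simp add: scalar_product_add)
    then obtain u y s where "z = u + y" "y \<in> minkowski_multiple s (V w d)"
      "\<not> (\<exists>x. scalar_product w x = d \<and> x \<le> u)"
      using less[of z] by blast
    moreover have "y + x \<in> minkowski_multiple (Suc s) (V w d)"
      using calculation(2) x(1) by (auto simp: minkowski_multiple_Suc V_def)
    moreover have "v = u + (y + x)"
      using calculation(1) v by (simp add: add.assoc)
    ultimately show ?thesis by (intro exI conjI)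
  qed
qed

lemma bubble_level_eq: "bubble_level w u = scalar_product w u div lcm_weight w"
  by (simp add: bubble_level_def floor_divide_of_nat_eq)

text \<open>\<open>bubble_m\<close> is the least positive number of summands whose capacity reaches
  the level of \<open>u\<close>.\<close>

lemma bubble_m_le:
  assumes "m \<ge> 1" "k \<ge> 1" "bubble_level w u \<le> m * k"
  shows "bubble_m w u k \<le> m"
proof -
  have "real (bubble_level w u) \<le> real m * real k"
    using assms(3) by (metis of_nat_le_iff of_nat_mult)
  then have "real (bubble_level w u) / real k \<le> real m"
    using assms(2) by (simp add: field_simps)
  then show ?thesis using assms(1) by (simp add: bubble_m_def ceiling_le_iff)
qed

lemma bubble_condition_iff:
  "bubble_condition w u k \<longleftrightarrow>
    (\<exists>y\<in>minkowski_multiple (bubble_r w u k) (V w (lcm_weight w)).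
      u + y \<notin> minkowski_multiple (bubble_m w u k) (V_plus w (k * lcm_weight w)))"
  unfolding bubble_condition_def minkowski_multiple_def[of "bubble_r w u k"] by blast

theorem proposition2p7:
  fixes w :: "nat ^ 'n" and k :: nat
  assumes "\<forall>i. w $ i \<ge> 1" and "k \<ge> 1"
  shows "generated_in_degree_1
      (veronese (k * lcm_weight w) (rees_component w :: nat \<Rightarrow> ('q::comm_ring_1, 'n) tx_poly set))
      (veronese_component (k * lcm_weight w) (rees_component w))
    \<longleftrightarrow> \<not> (\<exists>u. bubble w u \<and> bubble_condition w u k)"
proof -
  define D where "D = lcm_weight w"
  have D: "D > 0" using lcm_weight_pos[OF assms(1)] by (simp add: D_def)
  have "(\<forall>m\<ge>1. V_plus w (m * (k * D)) \<subseteq> minkowski_multiple m (V_plus w (k * D)))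
    \<longleftrightarrow> \<not> (\<exists>u. bubble w u \<and> bubble_condition w u k)"
  proof
    assume sub: "\<forall>m\<ge>1. V_plus w (m * (k * D)) \<subseteq> minkowski_multiple m (V_plus w (k * D))"
    have "\<not> bubble_condition w u k" for u
      unfolding bubble_condition_iff
    proof clarify
      fix y assume y: "y \<in> minkowski_multiple (bubble_r w u k) (V w (lcm_weight w))"
        and nin: "u + y \<notin> minkowski_multiple (bubble_m w u k) (V_plus w (k * lcm_weight w))"
      \<comment> \<open>The number \<open>bubble_r\<close> of added vectors is exactly what lifts
        the level of \<open>u\<close> to \<open>bubble_m w u k * k\<close>.\<close>
      have "bubble_m w u k * k = bubble_level w u + bubble_r w u k"
        using bubble_r_no_truncation[of k w u] assms(2) by (simp add: bubble_r_def)
      then have "bubble_m w u k * (k * D) = bubble_level w u * D + bubble_r w u k * D"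
        by (metis distrib_right mult.assoc)
      also have "\<dots> \<le> scalar_product w (u + y)"
        using scalar_product_minkowski_V[OF y]
        by (simp add: scalar_product_add bubble_level_eq D_def)
      finally have "u + y \<in> V_plus w (bubble_m w u k * (k * D))"
        by (simp add: V_plus_def)
      moreover have "bubble_m w u k \<ge> 1" by (simp add: bubble_m_def)
      ultimately show False using sub nin by (auto simp: D_def)
    qed
    then show "\<not> (\<exists>u. bubble w u \<and> bubble_condition w u k)" by blast
  next
    assume no: "\<not> (\<exists>u. bubble w u \<and> bubble_condition w u k)"
    show "\<forall>m\<ge>1. V_plus w (m * (k * D)) \<subseteq> minkowski_multiple m (V_plus w (k * D))"
    proof (intro allI impI subsetI)
      fix m :: nat and v assume m: "m \<ge> 1" and v: "v \<in> V_plus w (m * (k * D))"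
      show "v \<in> minkowski_multiple m (V_plus w (k * D))"
      proof (cases "v \<in> V_plus w ((m * k + 1) * D)")
        case True
        then show ?thesis
          using V_plus_subset_minkowski[OF assms(1) m assms(2)] by (auto simp: D_def)
      next
        case False
        obtain u y s where v_eq: "v = u + y" and y: "y \<in> minkowski_multiple s (V w D)"
          and u: "\<not> (\<exists>x. scalar_product w x = D \<and> x \<le> u)"
          using split_off_V[OF D] by blast
        define l where "l = bubble_level w u"
        have wv: "scalar_product w v = scalar_product w u + s * D"
          using scalar_product_minkowski_V[OF y] by (simp add: v_eq scalar_product_add)
        \<comment> \<open>The weight of \<open>v\<close> lies in
          \<open>[m k D, (m k + 1) D)\<close>. Each split-off vector lowers the quotient by one, so
          the level of \<open>u\<close> and \<open>s\<close> add up to \<open>m * k\<close>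
          exactly.\<close>
        have "scalar_product w v div D = m * k"
          using v False by (intro div_nat_eqI) (simp_all add: V_plus_def algebra_simps)
        then have ls: "l + s = m * k"
          using D unfolding wv l_def bubble_level_eq D_def[symmetric] by simp
        have V_sub: "minkowski_multiple j (V w D) \<subseteq> minkowski_multiple j (V_plus w D)" for j
          by (rule minkowski_multiple_mono) (auto simp: V_def V_plus_def)
        show ?thesis
        proof (cases "bubble w u")
          case True
          let ?m = "bubble_m w u k" and ?r = "bubble_r w u k"
          have m_le: "?m \<le> m"
            using bubble_m_le[OF m assms(2), of w u] ls by (simp add: l_def)
          have "?m * k = l + ?r"
            using bubble_r_no_truncation[of k w u] assms(2) by (simp add: bubble_r_def l_def)
          moreover have "m * k = ?m * k + (m - ?m) * k"
            using m_le by (simp flip: distrib_right)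
          \<comment> \<open>\<open>?r\<close> of the split-off vectors join \<open>u\<close>, where
            the hypothesis on bubbles applies; the others form the remaining \<open>m - ?m\<close>
            summands, \<open>k\<close> vectors each.\<close>
          ultimately have s: "s = ?r + (m - ?m) * k" using ls by linarith
          obtain y1 y2 where y12: "y = y1 + y2" "y1 \<in> minkowski_multiple ?r (V w D)"
            "y2 \<in> minkowski_multiple ((m - ?m) * k) (V w D)"
            using y unfolding s minkowski_multiple_add by blast
          have "u + y1 \<in> minkowski_multiple ?m (V_plus w (k * D))"
            using no True y12(2) by (auto simp: bubble_condition_iff D_def)
          moreover have "y2 \<in> minkowski_multiple (m - ?m) (V_plus w (k * D))"
            using y12(3) V_sub minkowski_V_plus_group by blast
          ultimately have "u + y1 + y2 \<in> minkowski_multiple (?m + (m - ?m)) (V_plus w (k * D))"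
            by (rule minkowski_multiple_addI)
          then show ?thesis using m_le by (simp add: v_eq y12(1) add.assoc)
        next
          case False
          then have "scalar_product w u < 2 * D"
            using u by (auto simp: bubble_def D_def not_le)
          then have "l < 2"
            by (simp add: l_def bubble_level_eq D_def less_mult_imp_div_less)
          then consider "l = 0" | "l = 1" by linarith
          then have "v \<in> minkowski_multiple (m * k) (V_plus w D)"
          proof cases
            \<comment> \<open>Here \<open>s = m * k\<close>, so \<open>y\<close> provides all
              summands and \<open>u\<close> is surplus.\<close>
            case 1
            then have "y \<in> minkowski_multiple (m * k) (V_plus w D)"
              using y ls V_sub by auto
            moreover have "m * k \<ge> 1" using m assms(2) by simp
            ultimately show ?thesis
              unfolding v_eq add.commute[of u] by (intro minkowski_V_plus_add)
          next
            \<comment> \<open>Here \<open>s = m * k - 1\<close>, and \<open>u\<close> itself is the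
              missing summand.\<close>
            case 2
            then have "1 * D \<le> scalar_product w u"
              using D by (simp only: l_def bubble_level_eq D_def[symmetric])
                (metis div_times_less_eq_dividend)
            then have "u \<in> minkowski_multiple (Suc 0) (V_plus w D)"
              by (simp add: minkowski_multiple_1 V_plus_def)
            then have "u + y \<in> minkowski_multiple (Suc 0 + s) (V_plus w D)"
              using y V_sub by (blast intro: minkowski_multiple_addI)
            then show ?thesis using 2 ls by (simp add: v_eq)
          qed
          then show ?thesis using minkowski_V_plus_group by blast
        qed
      qed
    qed
  qed
  moreover have "k * D > 0" using D assms(2) by simp
  ultimately show ?thesis
    using generated_in_degree_1_rees_iff[of "k * D" w, where 'q = 'q] by (simp add: D_def)
qed

end
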